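(* Let $(f_n)_{n\in\mathbb{N}}$ be a sequence of real valued measurable functions on $[0,1)$. The following are equivalent: (I) $(f_n)_n$ is statistically almost uniformly Cauchy. (II) There exists $B\subseteq\mathbb{N}$ with $d(B)=1$ such that the subsequence $(f_n)_{n\in B}$ is almost uniformly Cauchy. (III) There exist $B\subseteq\mathbb{N}$ with $d(B)=1$ and $f\in L^0$ such that the subsequence $(f_n)_{n\in B}$ converges almost uniformly to $f$. (IV) There exists $f\in L^0$ such that $(f_n)_n$ converges statistically almost uniformly to $f$.
   Context: $\mathbb{N}$ is the set of positive integers. The measure space is $([0,1),\Sigma,\lambda)$, with $\Sigma$ the $\sigma$-algebra of Lebesgue measurable subsets of $[0,1)$ and $\lambda$ Lebesgue measure. $L^0=L^0([0,1))$ is the space of real valued measurable functions on $[0,1)$, where functions equal $\lambda$-a.e. are identified. Density: for $A\subseteq\mathbb{N}$, $d(A)=\lim_{n\to\infty}\frac{|\{k\in A: k\le n\}|}{n}$, if this limit exists. Writing $d(A)=c$ means that the limit exists and equals $c$. Suprema over $x\notin D$ are over $x\in[0,1)\setminus D$ and may be $+\infty$. For an infinite set $B\subseteq\mathbb{N}$, $(f_n)_{n\in B}$ denotes the subsequence indexed by the elements of $B$ in increasing order. A sequence (or such a subsequence) is almost uniformly Cauchy if for every $\varepsilon>0$ there is $D\in\Sigma$ with $\lambda(D)<\varepsilon$ such that the restrictions of its terms to $[0,1)\setminus D$ form a uniformly Cauchy sequence; it converges almost uniformly to $f$ if for every $\varepsilon>0$ there is $D\in\Sigma$ with $\lambda(D)<\varepsilon$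 such that it converges uniformly to $f$ on $[0,1)\setminus D$. $(f_n)$ is statistically almost uniformly Cauchy if: for every $\varepsilon>0$ there is $D\in\Sigma$ with $\lambda(D)<\varepsilon$ such that for every $\varepsilon'>0$ there is $n_0\in\mathbb{N}$ with $$d\Big(\Big\{n\in\mathbb{N}:\sup_{x\notin D}|f_n(x)-f_{n_0}(x)|\ge\varepsilon'\Big\}\Big)=0.$$ $(f_n)$ converges statistically almost uniformly to $f$ if: for every $\varepsilon>0$ there is $D\in\Sigma$ with $\lambda(D)<\varepsilon$ such that for every $\varepsilon'>0$, $$d\Big(\Big\{n\in\mathbb{N}:\sup_{x\notin D}|f_n(x)-f(x)|\ge\varepsilon'\Big\}\Big)=0.$$ *)

theory Defs
  imports "HOL-Analysis.Analysis"
begin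

text \<open>
  The index set is the set of positive integers, rendered as \<open>{1..} :: nat set\<close>. A sequence is a
  function on \<^typ>\<open>nat\<close> whose value at \<open>0\<close> is never used.
\<close>

definition has_natural_density :: "nat set \<Rightarrow> real \<Rightarrow> bool" where
  "has_natural_density A c \<longleftrightarrow>
     (\<lambda>n. real (card {k \<in> A. 1 \<le> k \<and> k \<le> n}) / real n) \<longlonglongrightarrow> c"

abbreviation unit_measure :: "real measure" where
  "unit_measure \<equiv> lebesgue_on {0..<1}"

text \<open>
  The supremum is taken in the extended reals, since it may be infinite. Over the empty set it is
  \<open>-\<infinity>\<close>, which is irrelevant below: it is only compared with positive thresholds.
\<close>

definition sup_dist_off :: "real set \<Rightarrow> (real \<Rightarrow> real) \<Rightarrow> (real \<Rightarrow> real) \<Rightarrow> ereal" where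
  "sup_dist_off D g h = (SUP x \<in> {0..<1} - D. ereal \<bar>g x - h x\<bar>)"

definition subsequence_along :: "(nat \<Rightarrow> 'a) \<Rightarrow> nat set \<Rightarrow> nat \<Rightarrow> 'a" where
  "subsequence_along f B = (\<lambda>k. f (enumerate B k))"

definition almost_uniformly_Cauchy :: "(nat \<Rightarrow> real \<Rightarrow> real) \<Rightarrow> bool" where
  "almost_uniformly_Cauchy g \<longleftrightarrow>
     (\<forall>\<epsilon>>0. \<exists>D \<in> sets unit_measure. measure unit_measure D < \<epsilon> \<and>
        uniformly_Cauchy_on ({0..<1} - D) g)"

definition converges_almost_uniformly ::
    "(nat \<Rightarrow> real \<Rightarrow> real) \<Rightarrow> (real \<Rightarrow> real) \<Rightarrow> bool" where
  "converges_almost_uniformly g h \<longleftrightarrow>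
     (\<forall>\<epsilon>>0. \<exists>D \<in> sets unit_measure. measure unit_measure D < \<epsilon> \<and>
        uniform_limit ({0..<1} - D) g h sequentially)"

definition statistically_almost_uniformly_Cauchy :: "(nat \<Rightarrow> real \<Rightarrow> real) \<Rightarrow> bool" where
  "statistically_almost_uniformly_Cauchy f \<longleftrightarrow>
     (\<forall>\<epsilon>>0. \<exists>D \<in> sets unit_measure. measure unit_measure D < \<epsilon> \<and>
        (\<forall>\<epsilon>'>0. \<exists>n\<^sub>0\<ge>1.
           has_natural_density {n. 1 \<le> n \<and> sup_dist_off D (f n) (f n\<^sub>0) \<ge> ereal \<epsilon>'} 0))"

definition converges_statistically_almost_uniformly ::
    "(nat \<Rightarrow> real \<Rightarrow> real) \<Rightarrow> (real \<Rightarrow> real) \<Rightarrow> bool" where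
  "converges_statistically_almost_uniformly f h \<longleftrightarrow>
     (\<forall>\<epsilon>>0. \<exists>D \<in> sets unit_measure. measure unit_measure D < \<epsilon> \<and>
        (\<forall>\<epsilon>'>0.
           has_natural_density {n. 1 \<le> n \<and> sup_dist_off D (f n) h \<ge> ereal \<epsilon>'} 0))"

text \<open>
  An element of \<open>L\<^sup>0\<close> is given by a measurable representative. Both modes of convergence are
  insensitive to changing the limit on a null set, since the null set can be absorbed into \<open>D\<close>.
\<close>

abbreviation L0 :: "(real \<Rightarrow> real) set" where
  "L0 \<equiv> borel_measurable unit_measure"

end

theory Submission
  imports Defs
begin

text \<open>
  Statistical convergence is ordinary convergence once a set of indices of density zero has been
  thrown away, and what has to be shown is that a single such set works for all exceptional sets
  and all tolerances at once. This is possible because the sets of density zero form a P-ideal: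
  countably many of them are contained, each up to finitely many elements, in one set of density
  zero (\<open>density_zero_P_ideal\<close>).

  The four conditions are linked in a cycle. From (I), choose exceptional sets of measure less than
  \<open>1 / (m + 1)\<close> and tolerances \<open>1 / (j + 1)\<close>; the complement of the set provided by the P-ideal
  property is the index set in (II). From (II), completeness of the reals gives uniform convergence
  to the pointwise limit, which is measurable: this is (III). If (III) holds along \<open>B\<close>, then off
  each exceptional set the indices violating a given tolerance lie outside \<open>B\<close> up to finitely
  many, which is (IV). Finally, (IV) gives (I) by the triangle inequality, using as \<open>n\<^sub>0\<close> any index
  for which \<open>f n\<^sub>0\<close> is close to the limit; there is one because the set of all positive integers
  does not have density zero.
\<close>

section \<open>Sets of natural density zero\<close>

lemma has_natural_density_0_iff:
  "has_natural_density A 0 \<longleftrightarrow>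
     (\<forall>e>0. \<exists>N. \<forall>n\<ge>N. real (card {k \<in> A. 1 \<le> k \<and> k \<le> n}) \<le> e * real n)"
  (is "_ \<longleftrightarrow> (\<forall>e>0. \<exists>N. \<forall>n\<ge>N. real (?c n) \<le> e * real n)")
proof
  assume L: "has_natural_density A 0"
  show "\<forall>e>0. \<exists>N. \<forall>n\<ge>N. real (?c n) \<le> e * real n"
  proof (intro allI impI)
    fix e :: real
    assume "e > 0"
    with L obtain N where N: "\<And>n. n \<ge> N \<Longrightarrow> \<bar>real (?c n) / real n\<bar> < e"
      unfolding has_natural_density_def LIMSEQ_iff by auto
    have "real (?c n) \<le> e * real n" if "n \<ge> Suc N" for n
    proof -
      have "real (?c n) / real n < e" using N[of n] that by simp
      then show ?thesis using that by (simp add: divide_simps split: if_splits)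
    qed
    then show "\<exists>N. \<forall>n\<ge>N. real (?c n) \<le> e * real n" by blast
  qed
next
  assume R: "\<forall>e>0. \<exists>N. \<forall>n\<ge>N. real (?c n) \<le> e * real n"
  show "has_natural_density A 0"
    unfolding has_natural_density_def LIMSEQ_iff
  proof (intro allI impI)
    fix r :: real
    assume "r > 0"
    then obtain N where N: "\<And>n. n \<ge> N \<Longrightarrow> real (?c n) \<le> r / 2 * real n"
      using R[rule_format, of "r / 2"] by auto
    have "norm (real (?c n) / real n - 0) < r" if "n \<ge> Suc N" for n
    proof -
      have n: "real n > 0" using that by simp
      have "real (?c n) \<le> r / 2 * real n" using N that by simp
      also have "\<dots> < r * real n" using n \<open>r > 0\<close> by simp
      finally show ?thesis using n by (simp add: divide_simps)
    qed
    then show "\<exists>no. \<forall>n\<ge>no. norm (real (?c n) / real n - 0) < r" by blast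
  qed
qed

lemma card_initial_mono:
  fixes A B :: "nat set"
  assumes "\<And>k. k \<in> A \<Longrightarrow> 1 \<le> k \<Longrightarrow> k \<le> n \<Longrightarrow> k \<in> B"
  shows "card {k \<in> A. 1 \<le> k \<and> k \<le> n} \<le> card {k \<in> B. 1 \<le> k \<and> k \<le> n}"
proof (rule card_mono)
  show "finite {k \<in> B. 1 \<le> k \<and> k \<le> n}"
    by (rule finite_subset[of _ "{..n}"]) auto
qed (use assms in blast)

lemma density_zero_subset:
  assumes "has_natural_density B 0" "A \<inter> {1..} \<subseteq> B"
  shows "has_natural_density A 0"
proof -
  have "card {k \<in> A. 1 \<le> k \<and> k \<le> n} \<le> card {k \<in> B. 1 \<le> k \<and> k \<le> n}" for n
    using assms(2) by (intro card_initial_mono) auto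
  then have le: "real (card {k \<in> A. 1 \<le> k \<and> k \<le> n}) \<le> real (card {k \<in> B. 1 \<le> k \<and> k \<le> n})"
    for n
    by simp
  show ?thesis
    unfolding has_natural_density_0_iff
  proof (intro allI impI)
    fix e :: real
    assume "e > 0"
    then obtain N where
      "\<And>n. n \<ge> N \<Longrightarrow> real (card {k \<in> B. 1 \<le> k \<and> k \<le> n}) \<le> e * real n"
      using assms(1) unfolding has_natural_density_0_iff by meson
    then show "\<exists>N. \<forall>n\<ge>N. real (card {k \<in> A. 1 \<le> k \<and> k \<le> n}) \<le> e * real n"
      using order_trans[OF le] by blast
  qed
qed

lemma density_zero_finite:
  assumes "finite A"
  shows "has_natural_density A 0"
  unfolding has_natural_density_def
proof (rule tendsto_sandwich[where f = "\<lambda>_. 0"])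
  show "\<forall>\<^sub>F n in sequentially. real (card {k \<in> A. 1 \<le> k \<and> k \<le> n}) / real n \<le> real (card A) / real n"
    using assms by (intro always_eventually allI divide_right_mono) (auto intro: card_mono)
  show "(\<lambda>n. real (card A) / real n) \<longlonglongrightarrow> 0"
    by (rule lim_const_over_n)
qed auto

lemma density_zero_Un:
  assumes "has_natural_density A 0" "has_natural_density B 0"
  shows "has_natural_density (A \<union> B) 0"
  unfolding has_natural_density_def
proof (rule tendsto_sandwich[where f = "\<lambda>_. 0"])
  let ?c = "\<lambda>A n. card {k \<in> A. 1 \<le> k \<and> k \<le> (n::nat)}"
  have "?c (A \<union> B) n \<le> ?c A n + ?c B n" for n
  proof -
    have "{k \<in> A \<union> B. 1 \<le> k \<and> k \<le> n} = {k \<in> A. 1 \<le> k \<and> k \<le> n} \<union> {k \<in> B. 1 \<le> k \<and> k \<le> n}"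
      by auto
    then show ?thesis by (simp add: card_Un_le)
  qed
  then have "real (?c (A \<union> B) n) \<le> real (?c A n) + real (?c B n)" for n
    by (simp flip: of_nat_add)
  then show "\<forall>\<^sub>F n in sequentially.
      real (?c (A \<union> B) n) / real n \<le> real (?c A n) / real n + real (?c B n) / real n"
    by (simp add: divide_right_mono flip: add_divide_distrib)
  show "(\<lambda>n. real (?c A n) / real n + real (?c B n) / real n) \<longlonglongrightarrow> 0"
    using tendsto_add[OF assms[unfolded has_natural_density_def]] by simp
qed auto

lemma density_zero_UN_finite:
  assumes "finite I" "\<And>i. i \<in> I \<Longrightarrow> has_natural_density (A i) 0"
  shows "has_natural_density (\<Union>i\<in>I. A i) 0"
  using assms by (induction I) (auto intro: density_zero_Un density_zero_finite)

lemma density_one_iff_complement: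
  assumes "B \<subseteq> {1..}"
  shows "has_natural_density B 1 \<longleftrightarrow> has_natural_density ({1..} - B) 0"
proof -
  let ?c = "\<lambda>A n. real (card {k \<in> A. 1 \<le> k \<and> k \<le> (n::nat)})"
  have "?c B n + ?c ({1..} - B) n = real n" for n
  proof -
    have "{k \<in> B. 1 \<le> k \<and> k \<le> n} \<union> {k \<in> {1..} - B. 1 \<le> k \<and> k \<le> n} = {1..n}"
      by auto
    moreover have "card ({k \<in> B. 1 \<le> k \<and> k \<le> n} \<union> {k \<in> {1..} - B. 1 \<le> k \<and> k \<le> n})
        = card {k \<in> B. 1 \<le> k \<and> k \<le> n} + card {k \<in> {1..} - B. 1 \<le> k \<and> k \<le> n}"
      by (rule card_Un_disjoint) auto
    ultimately show ?thesis by (simp flip: of_nat_add)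
  qed
  then have eq: "?c ({1..} - B) n / real n = 1 - ?c B n / real n" if "n \<ge> 1" for n
    using that by (simp add: field_simps)
  have "has_natural_density ({1..} - B) 0 \<longleftrightarrow> (\<lambda>n. 1 - ?c B n / real n) \<longlonglongrightarrow> 0"
    unfolding has_natural_density_def
    by (rule tendsto_cong) (use eq in \<open>auto intro: eventually_sequentiallyI[of 1]\<close>)
  also have "\<dots> \<longleftrightarrow> has_natural_density B 1"
    unfolding has_natural_density_def
    using tendsto_diff[OF tendsto_const[of 1], of "\<lambda>n. ?c B n / real n" 1 sequentially]
      tendsto_diff[OF tendsto_const[of 1], of "\<lambda>n. 1 - ?c B n / real n" 0 sequentially]
    by auto
  finally show ?thesis by simp
qed

lemma density_one_infinite:
  assumes "has_natural_density B 1"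
  shows "infinite B"
  using density_zero_finite[of B] assms LIMSEQ_unique zero_neq_one
  unfolding has_natural_density_def by blast

text \<open>
  The set \<open>A i\<close> is truncated below a threshold \<open>N i\<close>, and \<open>Z\<close> collects the truncated sets. Up to
  \<open>n\<close>, only the indices \<open>i\<close> with \<open>N i \<le> n\<close> contribute to \<open>Z\<close>; if \<open>m\<close> is the largest of them, then
  \<open>Z\<close> is covered up to \<open>n\<close> by the first \<open>m + 1\<close> sets, and \<open>N m\<close> is chosen so large that their
  union has proportion at most \<open>1 / (m + 1)\<close> from \<open>N m\<close> on.
\<close>

lemma density_zero_P_ideal:
  fixes A :: "nat \<Rightarrow> nat set"
  assumes "\<And>i. has_natural_density (A i) 0"
  obtains Z where "has_natural_density Z 0" "\<And>i. finite (A i - Z)"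
proof -
  let ?c = "\<lambda>A n. real (card {k \<in> A. 1 \<le> k \<and> k \<le> (n::nat)})"
  define C where "C m = (\<Union>i\<le>m. A i)" for m
  have "\<exists>N. \<forall>n\<ge>N. ?c (C m) n \<le> 1 / real (Suc m) * real n" for m
  proof -
    have "has_natural_density (C m) 0"
      unfolding C_def using assms by (intro density_zero_UN_finite) auto
    then show ?thesis
      unfolding has_natural_density_0_iff
      by (elim allE[of _ "1 / real (Suc m)"] impE) simp
  qed
  then obtain N0 where N0: "\<And>m n. n \<ge> N0 m \<Longrightarrow> ?c (C m) n \<le> 1 / real (Suc m) * real n"
    by metis
  \<comment> \<open>With \<open>N i \<ge> i\<close>, only finitely many \<open>i\<close> satisfy \<open>N i \<le> n\<close>, so that a largest one exists.\<close>
  define N where "N m = max (N0 m) m" for m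
  define Z where "Z = {k. \<exists>i. k \<in> A i \<and> N i \<le> k}"
  have "finite (A i - Z)" for i
    by (rule finite_subset[of _ "{..<N i}"]) (auto simp: Z_def not_le)
  moreover have "has_natural_density Z 0"
    unfolding has_natural_density_0_iff
  proof (intro allI impI)
    fix e :: real
    assume "e > 0"
    then obtain m0 where m0: "1 / real (Suc m0) < e"
      using nat_approx_posE by blast
    have "?c Z n \<le> e * real n" if n: "n \<ge> N m0" for n
    proof -
      define M where "M = {i. N i \<le> n}"
      have "finite M"
        by (rule finite_subset[of _ "{..n}"]) (auto simp: M_def N_def)
      moreover have "m0 \<in> M"
        using n by (simp add: M_def)
      ultimately have m: "Max M \<in> M" "m0 \<le> Max M" "\<And>i. i \<in> M \<Longrightarrow> i \<le> Max M"
        by (auto intro: Max_in)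
      have "k \<in> C (Max M)" if k: "k \<in> Z" "k \<le> n" for k
      proof -
        from k obtain i where "k \<in> A i" "N i \<le> k"
          by (auto simp: Z_def)
        moreover from this k have "i \<le> Max M"
          by (intro m(3)) (auto simp: M_def)
        ultimately show ?thesis
          by (auto simp: C_def)
      qed
      then have "?c Z n \<le> ?c (C (Max M)) n"
        by (intro of_nat_mono card_initial_mono) auto
      also have "\<dots> \<le> 1 / real (Suc (Max M)) * real n"
        using m(1) by (intro N0) (auto simp: M_def N_def)
      also have "\<dots> \<le> 1 / real (Suc m0) * real n"
        using m(2) by (intro mult_right_mono divide_left_mono) auto
      also have "\<dots> \<le> e * real n"
        using m0 by (intro mult_right_mono) auto
      finally show ?thesis .
    qed
    then show "\<exists>N. \<forall>n\<ge>N. ?c Z n \<le> e * real n" by blast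
  qed
  ultimately show thesis using that by blast
qed

section \<open>Uniform distance and subsequences\<close>

lemma sup_dist_off_lessD:
  assumes "\<not> ereal e \<le> sup_dist_off D g h" "x \<in> {0..<1} - D"
  shows "\<bar>g x - h x\<bar> < e"
proof -
  have "ereal \<bar>g x - h x\<bar> \<le> sup_dist_off D g h"
    unfolding sup_dist_off_def using assms(2) by (rule SUP_upper)
  also have "\<dots> < ereal e"
    using assms(1) by simp
  finally show ?thesis by simp
qed

lemma sup_dist_off_lessI:
  assumes "\<And>x. x \<in> {0..<1} - D \<Longrightarrow> \<bar>g x - h x\<bar> \<le> d" "d < e"
  shows "\<not> ereal e \<le> sup_dist_off D g h"
proof -
  have "sup_dist_off D g h \<le> ereal d"
    unfolding sup_dist_off_def using assms(1) by (intro SUP_least) simp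
  then show ?thesis
    using assms(2) by (metis ereal_less_eq(3) not_le order_trans)
qed

lemma index_in_subsequence:
  fixes B :: "nat set"
  assumes "infinite B" "n \<in> B" "enumerate B K \<le> n"
  obtains k where "k \<ge> K" "enumerate B k = n"
  using enumerate_Ex[of B n] assms by (metis enumerate_mono_le_iff)

section \<open>The four implications\<close>

text \<open>
  For each exceptional set \<open>D m\<close> and tolerance \<open>1 / (j + 1)\<close>, the indices \<open>n\<close> for which \<open>f n\<close> is
  not within the tolerance of a suitable reference function \<open>f (p m j)\<close> form a set \<open>A m j\<close> of density
  zero. Outside the set \<open>Z\<close> given by the P-ideal property, only finitely many members of each
  \<open>A m j\<close> remain. So, off each \<open>D m\<close>, the functions with index outside \<open>Z\<close> are eventually within the
  tolerance of the reference function, hence within twice the tolerance of each other.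
\<close>

lemma statistically_Cauchy_imp_Cauchy_along:
  assumes "statistically_almost_uniformly_Cauchy f"
  obtains B where "B \<subseteq> {1..}" "has_natural_density B 1"
    "almost_uniformly_Cauchy (subsequence_along f B)"
proof -
  define good where "good D \<longleftrightarrow> (\<forall>e>0. \<exists>n\<^sub>0\<ge>1.
    has_natural_density {n. 1 \<le> n \<and> sup_dist_off D (f n) (f n\<^sub>0) \<ge> ereal e} 0)" for D
  have "\<exists>D. D \<in> sets unit_measure \<and> measure unit_measure D < 1 / real (Suc m) \<and> good D" for m
  proof -
    have "1 / real (Suc m) > 0" by simp
    then show ?thesis
      using assms unfolding statistically_almost_uniformly_Cauchy_def good_def by blast
  qed
  then obtain D where D: "\<And>m. D m \<in> sets unit_measure"
      "\<And>m. measure unit_measure (D m) < 1 / real (Suc m)" and good: "\<And>m. good (D m)"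
    by metis
  define F where
    "F m j q = {n. 1 \<le> n \<and> sup_dist_off (D m) (f n) (f q) \<ge> ereal (1 / real (Suc j))}" for m j q
  have "\<exists>q. has_natural_density (F m j q) 0" for m j
    using good[of m] unfolding good_def F_def
    by (elim allE[of _ "1 / real (Suc j)"] impE) auto
  then obtain p where p: "\<And>m j. has_natural_density (F m j (p m j)) 0"
    by metis
  define A where "A m j = F m j (p m j)" for m j
  \<comment> \<open>The sets \<open>A m j\<close> are enumerated as a single sequence.\<close>
  have "has_natural_density (case_prod A (prod_decode i)) 0" for i
    using p by (simp add: A_def split: prod.split)
  then obtain Z where Z: "has_natural_density Z 0"
    and fin: "\<And>i. finite (case_prod A (prod_decode i) - Z)"
    using density_zero_P_ideal[where A = "\<lambda>i. case_prod A (prod_decode i)"] by blast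
  have fin: "finite (A m j - Z)" for m j
    using fin[of "prod_encode (m, j)"] by simp
  define B where "B = {1..} - Z"
  have B: "B \<subseteq> {1..}" "has_natural_density B 1"
  proof -
    show "B \<subseteq> {1..}" by (auto simp: B_def)
    then show "has_natural_density B 1"
      by (subst density_one_iff_complement)
        (auto intro: density_zero_subset[OF Z] simp: B_def)
  qed
  have inf: "infinite B"
    using B(2) by (rule density_one_infinite)
  have "uniformly_Cauchy_on ({0..<1} - D m) (subsequence_along f B)" for m
    unfolding uniformly_Cauchy_on_def
  proof (intro allI impI)
    fix e :: real
    assume "e > 0"
    then obtain j where j: "1 / real (Suc j) < e / 2"
      using nat_approx_posE by (metis half_gt_zero)
    obtain K where K: "\<And>n. n \<in> A m j - Z \<Longrightarrow> n < K"
      using fin[of m j] unfolding finite_nat_set_iff_bounded by blast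
    have near: "dist (subsequence_along f B k x) (f (p m j) x) < e / 2"
      if "k \<ge> K" "x \<in> {0..<1} - D m" for k x
    proof -
      have "enumerate B k \<ge> K" "enumerate B k \<in> B"
        using that(1) le_enumerate[OF inf, of k] enumerate_in_set[OF inf] by auto
      then have "enumerate B k \<notin> A m j" "1 \<le> enumerate B k"
        using K by (auto simp: B_def dest: leD)
      then have "\<not> ereal (1 / real (Suc j)) \<le> sup_dist_off (D m) (f (enumerate B k)) (f (p m j))"
        by (simp add: A_def F_def)
      from sup_dist_off_lessD[OF this that(2)] j show ?thesis
        by (simp add: subsequence_along_def dist_real_def)
    qed
    show "\<exists>M. \<forall>x\<in>{0..<1} - D m. \<forall>k\<ge>M. \<forall>l\<ge>M.
        dist (subsequence_along f B k x) (subsequence_along f B l x) < e"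
      using near by (blast intro: dist_triangle_half_l)
  qed
  then have "almost_uniformly_Cauchy (subsequence_along f B)"
    unfolding almost_uniformly_Cauchy_def
    using D nat_approx_posE by (metis less_trans)
  with B show thesis using that by blast
qed

text \<open>
  The limit is chosen independently of the exceptional sets, as the pointwise limit where it
  exists. At the remaining points the value of \<^const>\<open>lim\<close> is unspecified, but the function is
  measurable nevertheless.
\<close>

lemma almost_uniformly_Cauchy_imp_converges:
  assumes "\<And>k. g k \<in> borel_measurable unit_measure" "almost_uniformly_Cauchy g"
  obtains h where "h \<in> L0" "converges_almost_uniformly g h"
proof
  show "(\<lambda>x. lim (\<lambda>k. g k x)) \<in> L0"
    using assms(1) by (rule borel_measurable_lim_metric)
  have "uniform_limit S g (\<lambda>x. lim (\<lambda>k. g k x)) sequentially" if "uniformly_Cauchy_on S g" for S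
  proof -
    from that have "uniformly_convergent_on S g"
      by (rule Cauchy_uniformly_convergent)
    then show ?thesis
      by (simp add: uniformly_convergent_uniform_limit_iff)
  qed
  then show "converges_almost_uniformly g (\<lambda>x. lim (\<lambda>k. g k x))"
    using assms(2) unfolding almost_uniformly_Cauchy_def converges_almost_uniformly_def by meson
qed

lemma converges_along_imp_converges_statistically:
  assumes "B \<subseteq> {1..}" "has_natural_density B 1"
    "converges_almost_uniformly (subsequence_along f B) h"
  shows "converges_statistically_almost_uniformly f h"
proof -
  have inf: "infinite B"
    using assms(2) by (rule density_one_infinite)
  have "has_natural_density {n. 1 \<le> n \<and> sup_dist_off D (f n) h \<ge> ereal e} 0"
    if lim: "uniform_limit ({0..<1} - D) (subsequence_along f B) h sequentially" and "e > 0" for D e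
  proof -
    from lim \<open>e > 0\<close> obtain K where K: "\<And>k x. k \<ge> K \<Longrightarrow> x \<in> {0..<1} - D \<Longrightarrow>
        dist (subsequence_along f B k x) (h x) < e / 2"
      unfolding uniform_limit_sequentially_iff by (meson half_gt_zero)
    have "\<not> ereal e \<le> sup_dist_off D (f n) h" if n: "n \<in> B" "enumerate B K \<le> n" for n
    proof -
      obtain k where k: "k \<ge> K" "enumerate B k = n"
        using index_in_subsequence[OF inf n] by blast
      show ?thesis
      proof (rule sup_dist_off_lessI[where d = "e / 2"])
        show "\<bar>f n x - h x\<bar> \<le> e / 2" if "x \<in> {0..<1} - D" for x
          using K[OF k(1) that] k(2) by (simp add: subsequence_along_def dist_real_def)
      qed (use \<open>e > 0\<close> in simp)
    qed
    then have "{n. 1 \<le> n \<and> sup_dist_off D (f n) h \<ge> ereal e} \<inter> {1..}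
        \<subseteq> ({1..} - B) \<union> {..<enumerate B K}"
      using leI by blast
    moreover have "has_natural_density (({1..} - B) \<union> {..<enumerate B K}) 0"
      using assms(2) density_one_iff_complement[OF assms(1)]
      by (intro density_zero_Un density_zero_finite[OF finite_lessThan]) blast
    ultimately show ?thesis
      using density_zero_subset by blast
  qed
  then show ?thesis
    using assms(3)
    unfolding converges_almost_uniformly_def converges_statistically_almost_uniformly_def by meson
qed

lemma converges_statistically_imp_statistically_Cauchy:
  assumes "converges_statistically_almost_uniformly f h"
  shows "statistically_almost_uniformly_Cauchy f"
proof -
  have "\<exists>n\<^sub>0\<ge>1. has_natural_density {n. 1 \<le> n \<and> sup_dist_off D (f n) (f n\<^sub>0) \<ge> ereal e} 0"
    if dens: "\<forall>e>0. has_natural_density {n. 1 \<le> n \<and> sup_dist_off D (f n) h \<ge> ereal e} 0"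
      and "e > 0" for D and e :: real
  proof -
    \<comment> \<open>A third of the tolerance, not a half: passing from pointwise bounds to the supremum
        loses strictness.\<close>
    define E where "E = {n. 1 \<le> n \<and> sup_dist_off D (f n) h \<ge> ereal (e / 3)}"
    have E: "has_natural_density E 0"
      unfolding E_def using dens \<open>e > 0\<close> by simp
    then have "has_natural_density ({1..} - E) 1"
      by (subst density_one_iff_complement) (auto intro: density_zero_subset)
    then obtain n\<^sub>0 where n0: "n\<^sub>0 \<ge> 1" "n\<^sub>0 \<notin> E"
      using density_one_infinite by (metis Diff_iff atLeast_iff finite.emptyI ex_in_conv)
    have "\<not> ereal e \<le> sup_dist_off D (f n) (f n\<^sub>0)" if "n \<ge> 1" "n \<notin> E" for n
    proof (rule sup_dist_off_lessI[where d = "2 * e / 3"])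
      fix x
      assume x: "x \<in> {0..<1} - D"
      have "\<bar>f k x - h x\<bar> < e / 3" if "k \<ge> 1" "k \<notin> E" for k
        using that by (intro sup_dist_off_lessD[OF _ x]) (simp add: E_def)
      from this[OF that] this[OF n0]
      show "\<bar>f n x - f n\<^sub>0 x\<bar> \<le> 2 * e / 3"
        by linarith
    qed (use \<open>e > 0\<close> in simp)
    then have "{n. 1 \<le> n \<and> sup_dist_off D (f n) (f n\<^sub>0) \<ge> ereal e} \<inter> {1..} \<subseteq> E"
      by auto
    with E n0(1) show ?thesis
      using density_zero_subset by blast
  qed
  then show ?thesis
    using assms unfolding statistically_almost_uniformly_Cauchy_def
      converges_statistically_almost_uniformly_def by meson
qed

theorem theorem3p3:
  fixes f :: "nat \<Rightarrow> real \<Rightarrow> real"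
  assumes meas: "\<And>n. n \<ge> 1 \<Longrightarrow> f n \<in> borel_measurable unit_measure"
  defines "I \<equiv> statistically_almost_uniformly_Cauchy f"
    and "II \<equiv> (\<exists>B \<subseteq> {1..}. has_natural_density B 1 \<and>
                 almost_uniformly_Cauchy (subsequence_along f B))"
    and "III \<equiv> (\<exists>B \<subseteq> {1..}. has_natural_density B 1 \<and>
                 (\<exists>h \<in> L0. converges_almost_uniformly (subsequence_along f B) h))"
    and "IV \<equiv> (\<exists>h \<in> L0. converges_statistically_almost_uniformly f h)"
  shows "(I \<longleftrightarrow> II) \<and> (II \<longleftrightarrow> III) \<and> (III \<longleftrightarrow> IV)"
proof -
  have "II" if "I"
    using that statistically_Cauchy_imp_Cauchy_along unfolding I_def II_def by metis
  moreover have "III" if "II"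
  proof -
    from that obtain B where B: "B \<subseteq> {1..}" "has_natural_density B 1"
        "almost_uniformly_Cauchy (subsequence_along f B)"
      unfolding II_def by blast
    have "enumerate B k \<ge> 1" for k
      using enumerate_in_set[OF density_one_infinite[OF B(2)]] B(1) by (metis atLeast_iff subsetD)
    then have "subsequence_along f B k \<in> borel_measurable unit_measure" for k
      unfolding subsequence_along_def by (rule meas)
    then obtain h where "h \<in> L0" "converges_almost_uniformly (subsequence_along f B) h"
      using B(3) by (rule almost_uniformly_Cauchy_imp_converges)
    with B(1,2) show ?thesis
      unfolding III_def by blast
  qed
  moreover have "IV" if "III"
    using that converges_along_imp_converges_statistically unfolding III_def IV_def by metis
  moreover have "I" if "IV"
    using that converges_statistically_imp_statistically_Cauchy unfolding IV_def I_def by metis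
  ultimately show ?thesis by blast
qed

end
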